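(* Let $R$ be a semiprime ring with $|\min(R)|<\infty$ and $|\min(Z(R))|<\infty$. Then the following statements are equivalent: 1. $\mathcal{C}_{Z(R)}\subseteq\mathcal{C}_R$. 2. $\mathcal{C}_{Z(R)}\cap\mathfrak{p}=\emptyset$ for all $\mathfrak{p}\in\min(R)$. 3. The map $\rho_{R,\min}:\min(R)\to\min(Z(R))$, $\mathfrak{p}\mapsto\mathfrak{p}\cap Z(R)$, is a well-defined map (i.e. $\mathfrak{p}\cap Z(R)\in\min(Z(R))$ for all $\mathfrak{p}\in\min(R)$). 4. The map $\rho_{R,\min}$ is a surjection (i.e. $\mathfrak{p}\mapsto\mathfrak{p}\cap Z(R)$ is a well-defined surjective map from $\min(R)$ onto $\min(Z(R))$).
   Context: Rings are associative with $1$. $Z(R)$ is the centre of $R$. $\mathcal{C}_R$ is the set of regular elements (non-zero-divisors) of $R$, and $\mathcal{C}_{Z(R)}$ is the set of regular elements of the ring $Z(R)$. $\min(R)$ is the set of minimal prime ideals of $R$. A ring is semiprime if the intersection of its prime ideals is zero. *)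

theory Defs
  imports "HOL-Algebra.Ideal_Product" "HOL-Algebra.Subrings"
begin

definition centre :: "('a, 'm) ring_scheme \<Rightarrow> 'a set"
  where "centre R = {z \<in> carrier R. \<forall>x \<in> carrier R. z \<otimes>\<^bsub>R\<^esub> x = x \<otimes>\<^bsub>R\<^esub> z}"

definition centre_ring :: "('a, 'm) ring_scheme \<Rightarrow> ('a, 'm) ring_scheme"
  where "centre_ring R = R\<lparr>carrier := centre R\<rparr>"

text \<open>Regular on both sides. Zero divisors are sought in the carrier of the ring in question, so
  an element regular in the centre need not be regular in the whole ring.\<close>

definition regular_elements :: "('a, 'm) ring_scheme \<Rightarrow> 'a set"
  where "regular_elements R =
    {c \<in> carrier R. \<forall>x \<in> carrier R.
       (c \<otimes>\<^bsub>R\<^esub> x = \<zero>\<^bsub>R\<^esub> \<longrightarrow> x = \<zero>\<^bsub>R\<^esub>) \<and> (x \<otimes>\<^bsub>R\<^esub> c = \<zero>\<^bsub>R\<^esub> \<longrightarrow> x = \<zero>\<^bsub>R\<^esub>)}"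

text \<open>The library's \<^locale>\<open>primeideal\<close> is elementwise and built on \<^locale>\<open>cring\<close>; over an
  arbitrary ring primality is tested on products of two-sided ideals. The two notions agree for
  commutative rings, see \<open>nc_primeideal_iff_primeideal\<close> below.\<close>

locale nc_primeideal = ideal P R for P and R (structure) +
  assumes proper: "P \<noteq> carrier R"
    and prime: "\<lbrakk>ideal I R; ideal J R; ideal_prod R I J \<subseteq> P\<rbrakk> \<Longrightarrow> I \<subseteq> P \<or> J \<subseteq> P"

definition minimal_primes :: "('a, 'm) ring_scheme \<Rightarrow> 'a set set"
  where "minimal_primes R =
    {P. nc_primeideal P R \<and> (\<forall>Q. nc_primeideal Q R \<and> Q \<subseteq> P \<longrightarrow> Q = P)}"

text \<open>The intersection of the primes is formed inside the carrier, so that the empty intersection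
  is the whole ring; hence the zero ring is semiprime.\<close>

locale semiprime_ring = ring +
  assumes prime_radical_zero: "{x \<in> carrier R. \<forall>P. nc_primeideal P R \<longrightarrow> x \<in> P} = {\<zero>}"

definition rho_min :: "('a, 'm) ring_scheme \<Rightarrow> 'a set \<Rightarrow> 'a set"
  where "rho_min R P = P \<inter> centre R"

lemma (in cring) nc_primeideal_iff_primeideal: "nc_primeideal P R \<longleftrightarrow> primeideal P R"
proof
  assume P: "nc_primeideal P R"
  interpret P: nc_primeideal P R by (rule P)
  show "primeideal P R"
    by (rule divides_ideal_prod_imp_primeideal [OF P.is_ideal P.proper P.prime])
next
  assume P: "primeideal P R"
  interpret P: primeideal P R by (rule P)
  show "nc_primeideal P R"
    by (intro nc_primeideal.intro nc_primeideal_axioms.intro P.is_ideal P.I_notcarr [symmetric]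
        primeideal_divides_ideal_prod [OF P])
qed

lemma (in ring) centre_subcring: "subcring (centre R) R"
proof (intro subcringI subringI)
  have carr: "h \<in> carrier R" if "h \<in> centre R" for h
    using that by (simp add: centre_def)
  have comm: "h \<otimes> x = x \<otimes> h" if "h \<in> centre R" "x \<in> carrier R" for h x
    using that by (simp add: centre_def)
  have centreI: "h \<in> centre R" if "h \<in> carrier R" "\<And>x. x \<in> carrier R \<Longrightarrow> h \<otimes> x = x \<otimes> h" for h
    using that by (simp add: centre_def)
  show "centre R \<subseteq> carrier R" using carr by blast
  show "\<one> \<in> centre R" by (rule centreI) simp_all
  fix h assume h: "h \<in> centre R"
  show "\<ominus> h \<in> centre R"
    by (rule centreI) (simp_all add: carr h l_minus r_minus comm [OF h])
  fix k assume k: "k \<in> centre R"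
  show "h \<otimes> k = k \<otimes> h" by (rule comm [OF h carr [OF k]])
  show "h \<oplus> k \<in> centre R"
    by (rule centreI) (simp_all add: carr h k l_distr r_distr comm [OF h] comm [OF k])
  show "h \<otimes> k \<in> centre R"
  proof (rule centreI)
    fix x assume x: "x \<in> carrier R"
    have "h \<otimes> k \<otimes> x = h \<otimes> (x \<otimes> k)"
      by (simp only: m_assoc carr h k x comm [OF k x])
    also have "\<dots> = x \<otimes> h \<otimes> k"
      by (simp only: m_assoc [symmetric] carr h k x comm [OF h x])
    finally show "h \<otimes> k \<otimes> x = x \<otimes> (h \<otimes> k)"
      by (simp only: m_assoc carr h k x)
  qed (simp add: carr h k)
qed

lemma (in ring) centre_ring_is_cring: "cring (centre_ring R)"
  unfolding centre_ring_def
  by (rule subcring_iff [THEN iffD1, OF subcringE(1) [OF centre_subcring] centre_subcring])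

end

theory Submission
  imports Defs
begin

text \<open>In a semiprime ring with finitely many minimal primes, a central element is regular exactly
  when it avoids all minimal primes: if it lies in one of them, multiply it by an element of the
  others outside this one; if it avoids them all, its annihilator lies in each of them. The centre is
  itself semiprime, since primes contract to primes, so the same criterion holds there. Applied to
  both rings it gives the equivalence of the first two conditions, and it shows that the second one
  says that the minimal primes of the ring contract into the union of the minimal primes of the
  centre, hence into one of them by prime avoidance. Surjectivity is automatic because the
  contractions of the minimal primes have zero intersection.\<close>

section \<open>Primes over an arbitrary ring: finite intersections, avoidance, existence of minimal
  primes\<close>

lemma minimal_primesD:
  assumes "P \<in> minimal_primes R"
  shows "nc_primeideal P R" and "\<And>Q. \<lbrakk>nc_primeideal Q R; Q \<subseteq> P\<rbrakk> \<Longrightarrow> Q = P"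
  using assms by (auto simp: minimal_primes_def)

lemma (in ring) ideal_add_right_cancel:
  assumes "ideal I R" "x \<in> I" "y \<in> carrier R" "x \<oplus> y \<in> I"
  shows "y \<in> I"
proof -
  interpret I: ideal I R by fact
  have "\<ominus> x \<oplus> (x \<oplus> y) \<in> I"
    by (rule I.a_closed [OF I.a_inv_closed [OF assms(2)] assms(4)])
  then show ?thesis using I.Icarr [OF assms(2)] assms(3) by (simp add: r_neg1)
qed

text \<open>A product of two ideals lies in their intersection, so primality splits off one member
  of \<open>S\<close> at a time. Meeting with \<open>carrier R\<close> makes the empty intersection
  the whole ring, which properness excludes.\<close>

lemma (in ring) nc_primeideal_Inter:
  assumes "nc_primeideal P R" "finite S" "\<And>I. I \<in> S \<Longrightarrow> ideal I R"
    and "carrier R \<inter> \<Inter>S \<subseteq> P"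
  shows "\<exists>I\<in>S. I \<subseteq> P"
  using assms(2-)
proof (induction S rule: finite_induct)
  case empty
  interpret P: nc_primeideal P R by fact
  show ?case using empty P.proper P.a_subset by auto
next
  case (insert I S)
  interpret P: nc_primeideal P R by fact
  \<comment> \<open>Inserting the carrier keeps the family nonempty, so \<open>?K\<close> is an
    ideal even when \<open>S\<close> is empty.\<close>
  let ?K = "\<Inter>(insert (carrier R) S)"
  have I: "ideal I R" and K: "ideal ?K R"
    using insert.prems(1) oneideal by (blast, intro i_Intersect) auto
  have "I \<cdot> ?K \<subseteq> I \<inter> ?K" by (rule ideal_prod_inter [OF I K])
  also have "\<dots> \<subseteq> P" using insert.prems(2) by auto
  finally have "I \<subseteq> P \<or> ?K \<subseteq> P" by (rule P.prime [OF I K])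
  then show ?case using insert.IH insert.prems(1) by auto
qed

text \<open>The classical argument, with the preceding lemma in place of products of elements.
  Members strictly inside others are discarded. Otherwise, if \<open>I\<close> lay in no member,
  some \<open>x\<close> in \<open>I\<close> would lie in \<open>Q\<close> alone and some
  \<open>y\<close> in \<open>I\<close> would lie in every member but \<open>Q\<close>, so
  \<open>x \<oplus> y\<close> would escape the union.\<close>

lemma (in ring) nc_prime_avoidance:
  assumes "finite S" "\<And>Q. Q \<in> S \<Longrightarrow> nc_primeideal Q R" "ideal I R" "I \<subseteq> \<Union>S"
  shows "\<exists>Q\<in>S. I \<subseteq> Q"
  using assms(1,2,4)
proof (induction S rule: finite_psubset_induct)
  case (psubset S)
  interpret I: ideal I R by fact
  show ?case
  proof (cases "\<exists>Q\<in>S. \<exists>Q'\<in>S. Q \<subset> Q'")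
    case True
    then obtain Q Q' where Q: "Q \<in> S" "Q' \<in> S" "Q \<subset> Q'" by blast
    then have "\<Union>S \<subseteq> \<Union>(S - {Q})" by blast
    then have "\<exists>Q\<in>S - {Q}. I \<subseteq> Q"
      by (intro psubset.IH) (use Q psubset.prems in auto)
    then show ?thesis by blast
  next
    case False
    show ?thesis
    proof (rule ccontr)
      assume not: "\<not> (\<exists>Q\<in>S. I \<subseteq> Q)"
      obtain Q where Q: "Q \<in> S" using I.zero_closed psubset.prems(2) by blast
      have QP: "nc_primeideal Q R" by (rule psubset.prems(1) [OF Q])
      have id: "ideal J R" if "J \<in> S" for J
        using psubset.prems(1) [OF that] by (rule nc_primeideal.axioms)
      \<comment> \<open>Otherwise the induction hypothesis would put \<open>I\<close> inside a
        single member.\<close>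
      have "\<not> I \<subseteq> \<Union>(S - {Q})"
        using psubset.IH [of "S - {Q}"] Q psubset.prems(1) not by blast
      then obtain x where x: "x \<in> I" "\<And>J. J \<in> S \<Longrightarrow> J \<noteq> Q \<Longrightarrow> x \<notin> J" by auto
      then have xQ: "x \<in> Q" using psubset.prems(2) by blast
      \<comment> \<open>Otherwise \<open>Q\<close> would contain \<open>I\<close> or, strictly,
        another member of \<open>S\<close>; both are excluded.\<close>
      have "\<not> carrier R \<inter> \<Inter>(insert I (S - {Q})) \<subseteq> Q"
      proof
        assume "carrier R \<inter> \<Inter>(insert I (S - {Q})) \<subseteq> Q"
        then have "\<exists>J\<in>insert I (S - {Q}). J \<subseteq> Q"
          by (intro nc_primeideal_Inter [OF QP]) (use psubset.hyps id assms(3) in auto)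
        then show False using not False Q by blast
      qed
      then obtain y where y: "y \<in> carrier R" "y \<in> I" "y \<notin> Q"
          "\<And>J. J \<in> S \<Longrightarrow> J \<noteq> Q \<Longrightarrow> y \<in> J"
        by auto
      obtain J where J: "J \<in> S" "x \<oplus> y \<in> J"
        using I.a_closed [OF x(1) y(2)] psubset.prems(2) by blast
      have xR: "x \<in> carrier R" using x(1) by (rule I.Icarr)
      show False
      proof (cases "J = Q")
        case True
        then show False using ideal_add_right_cancel [OF id [OF Q] xQ y(1)] J(2) y(3) by blast
      next
        case False
        have "y \<oplus> x \<in> J" using J(2) xR y(1) by (simp add: a_comm)
        then show False
          using ideal_add_right_cancel [OF id [OF J(1)] y(4) [OF J(1) False] xR] x(2) [OF J(1) False]
          by blast
      qed
    qed
  qed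
qed

text \<open>If \<open>I\<close> is not inside \<open>P\<close> and \<open>J\<close> is not inside
  \<open>Q\<close>, then neither is inside the smaller of \<open>P\<close> and \<open>Q\<close>,
  against the primality of that one. This provides the lower bounds for Zorn's lemma.\<close>

lemma (in ring) nc_primeideal_chain_Inter:
  assumes "C \<noteq> {}" "\<And>P. P \<in> C \<Longrightarrow> nc_primeideal P R"
    and chain: "\<And>P Q. \<lbrakk>P \<in> C; Q \<in> C\<rbrakk> \<Longrightarrow> P \<subseteq> Q \<or> Q \<subseteq> P"
  shows "nc_primeideal (\<Inter>C) R"
proof (intro nc_primeideal.intro nc_primeideal_axioms.intro)
  have id: "ideal P R" if "P \<in> C" for P
    using assms(2) [OF that] by (rule nc_primeideal.axioms)
  show "ideal (\<Inter>C) R" by (intro i_Intersect id assms(1))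
  obtain P where P: "P \<in> C" using assms(1) by blast
  interpret P: nc_primeideal P R by (rule assms(2) [OF P])
  show "\<Inter>C \<noteq> carrier R" using P P.proper P.a_subset by blast
  fix I J assume IJ: "ideal I R" "ideal J R" "I \<cdot> J \<subseteq> \<Inter>C"
  have or: "I \<subseteq> P \<or> J \<subseteq> P" if "P \<in> C" for P
    by (rule nc_primeideal.prime [OF assms(2) [OF that] IJ(1,2)]) (use IJ(3) that in blast)
  show "I \<subseteq> \<Inter>C \<or> J \<subseteq> \<Inter>C"
  proof (rule ccontr)
    assume "\<not> (I \<subseteq> \<Inter>C \<or> J \<subseteq> \<Inter>C)"
    then obtain P Q where "P \<in> C" "\<not> I \<subseteq> P" "Q \<in> C" "\<not> J \<subseteq> Q" by blast
    then show False using chain [of P Q] or [of P] or [of Q] by blast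
  qed
qed

lemma (in ring) minimal_prime_below:
  assumes "nc_primeideal P R"
  shows "\<exists>Q\<in>minimal_primes R. Q \<subseteq> P"
proof -
  define A where "A = {Q. nc_primeideal Q R \<and> Q \<subseteq> P}"
  \<comment> \<open>Reversed inclusion, so that the maximal element given by Zorn's lemma is a
    minimal prime.\<close>
  let ?r = "\<lambda>X Y :: 'a set. Y \<subseteq> X"
  have "\<exists>M\<in>A. \<forall>Q\<in>A. ?r M Q \<longrightarrow> Q = M"
  proof (rule predicate_Zorn)
    show "partial_order_on A (relation_of ?r A)"
      by (rule partial_order_on_relation_ofI) auto
    fix C assume C: "C \<in> Chains (relation_of ?r A)"
    then have CA: "C \<subseteq> A" by (rule Chains_relation_of)
    show "\<exists>u\<in>A. \<forall>a\<in>C. u \<subseteq> a"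
    proof (cases "C = {}")
      case True
      then show ?thesis using assms by (auto simp: A_def)
    next
      case False
      have "nc_primeideal (\<Inter>C) R"
        by (rule nc_primeideal_chain_Inter [OF False])
          (use C CA in \<open>unfold A_def Chains_def relation_of_def, blast+\<close>)
      then have "\<Inter>C \<in> A" using CA False by (auto simp: A_def)
      then show ?thesis by blast
    qed
  qed
  then obtain M where M: "M \<in> A" "\<And>Q. Q \<in> A \<Longrightarrow> Q \<subseteq> M \<Longrightarrow> Q = M" by blast
  then have "M \<in> minimal_primes R" by (auto simp: A_def minimal_primes_def)
  then show ?thesis using M(1) by (auto simp: A_def)
qed

section \<open>Central elements and noncommutative primes\<close>

lemma centreD:
  assumes "c \<in> centre R"
  shows "c \<in> carrier R" and "\<And>x. x \<in> carrier R \<Longrightarrow> c \<otimes>\<^bsub>R\<^esub> x = x \<otimes>\<^bsub>R\<^esub> c"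
  using assms by (auto simp: centre_def)

text \<open>Centrality makes this colon two-sided: \<open>c\<close> can be moved past a left
  factor.\<close>

lemma (in ring) ideal_centre_colon:
  assumes "ideal P R" "c \<in> centre R"
  shows "ideal {x \<in> carrier R. c \<otimes> x \<in> P} R"
proof -
  interpret P: ideal P R by fact
  note c = centreD [OF assms(2)]
  show ?thesis
  proof (intro idealI ring_axioms add.subgroupI)
    show "{x \<in> carrier R. c \<otimes> x \<in> P} \<noteq> {}" using c(1) P.zero_closed by (auto intro!: exI [of _ \<zero>])
    fix a assume a: "a \<in> {x \<in> carrier R. c \<otimes> x \<in> P}"
    show "\<ominus> a \<in> {x \<in> carrier R. c \<otimes> x \<in> P}"
      using a c(1) by (simp add: r_minus P.a_inv_closed)
    fix x assume x: "x \<in> carrier R"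
    have "c \<otimes> (x \<otimes> a) = x \<otimes> (c \<otimes> a)"
      using a c(1) c(2) [OF x] x by (simp add: m_assoc [symmetric])
    then show "x \<otimes> a \<in> {x \<in> carrier R. c \<otimes> x \<in> P}"
      using a x by (simp add: P.I_l_closed)
    show "a \<otimes> x \<in> {x \<in> carrier R. c \<otimes> x \<in> P}"
      using a x c(1) P.I_r_closed [of "c \<otimes> a" x] by (simp add: m_assoc)
  next
    fix a b assume "a \<in> {x \<in> carrier R. c \<otimes> x \<in> P}" "b \<in> {x \<in> carrier R. c \<otimes> x \<in> P}"
    then show "a \<oplus> b \<in> {x \<in> carrier R. c \<otimes> x \<in> P}"
      using c(1) by (simp add: r_distr P.a_closed)
  qed auto
qed

text \<open>Closure under right factors holds because \<open>I\<close> absorbs them from the left: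
  \<open>a \<otimes> x \<otimes> i = a \<otimes> (x \<otimes> i)\<close>.\<close>

lemma (in ring) ideal_left_colon:
  assumes "ideal P R" "ideal I R"
  shows "ideal {y \<in> carrier R. \<forall>i\<in>I. y \<otimes> i \<in> P} R"
proof -
  interpret P: ideal P R by fact
  interpret I: ideal I R by fact
  show ?thesis
  proof (intro idealI ring_axioms add.subgroupI)
    show "{y \<in> carrier R. \<forall>i\<in>I. y \<otimes> i \<in> P} \<noteq> {}"
      using P.zero_closed I.Icarr by (auto intro!: exI [of _ \<zero>])
    fix a assume a: "a \<in> {y \<in> carrier R. \<forall>i\<in>I. y \<otimes> i \<in> P}"
    show "\<ominus> a \<in> {y \<in> carrier R. \<forall>i\<in>I. y \<otimes> i \<in> P}"
      using a by (simp add: l_minus P.a_inv_closed I.Icarr)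
    fix x assume x: "x \<in> carrier R"
    show "x \<otimes> a \<in> {y \<in> carrier R. \<forall>i\<in>I. y \<otimes> i \<in> P}"
      using a x by (simp add: m_assoc I.Icarr P.I_l_closed)
    show "a \<otimes> x \<in> {y \<in> carrier R. \<forall>i\<in>I. y \<otimes> i \<in> P}"
      using a x by (simp add: m_assoc I.Icarr I.I_l_closed)
  next
    fix a b
    assume "a \<in> {y \<in> carrier R. \<forall>i\<in>I. y \<otimes> i \<in> P}" "b \<in> {y \<in> carrier R. \<forall>i\<in>I. y \<otimes> i \<in> P}"
    then show "a \<oplus> b \<in> {y \<in> carrier R. \<forall>i\<in>I. y \<otimes> i \<in> P}"
      by (simp add: l_distr P.a_closed I.Icarr)
  qed auto
qed

text \<open>Primality becomes elementwise once one factor is central. The two colons give ideals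
  \<open>J\<close> and \<open>I\<close> with product inside \<open>P\<close>, where \<open>x\<close>
  lies in \<open>I\<close> and \<open>c\<close> lies in \<open>J\<close> by the definition of
  \<open>I\<close>.\<close>

lemma (in ring) nc_primeideal_centre_mult:
  assumes "nc_primeideal P R" "c \<in> centre R" "x \<in> carrier R" "c \<otimes> x \<in> P"
  shows "c \<in> P \<or> x \<in> P"
proof -
  interpret P: nc_primeideal P R by fact
  define I where "I = {x \<in> carrier R. c \<otimes> x \<in> P}"
  define J where "J = {y \<in> carrier R. \<forall>i\<in>I. y \<otimes> i \<in> P}"
  have I: "ideal I R" unfolding I_def by (rule ideal_centre_colon [OF P.is_ideal assms(2)])
  have J: "ideal J R" unfolding J_def by (rule ideal_left_colon [OF P.is_ideal I])
  have "J \<cdot> I \<subseteq> P"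
  proof
    fix s assume "s \<in> J \<cdot> I"
    then show "s \<in> P" by induction (auto simp: J_def P.a_closed)
  qed
  then have "J \<subseteq> P \<or> I \<subseteq> P" by (rule P.prime [OF J I])
  moreover have "c \<in> J" "x \<in> I"
    using assms(3,4) centreD(1) [OF assms(2)] by (auto simp: I_def J_def)
  ultimately show ?thesis by blast
qed

section \<open>Contraction of primes to the centre\<close>

lemma centre_ring_simps [simp]:
  "carrier (centre_ring R) = centre R"
  "x \<otimes>\<^bsub>centre_ring R\<^esub> y = x \<otimes>\<^bsub>R\<^esub> y"
  "x \<oplus>\<^bsub>centre_ring R\<^esub> y = x \<oplus>\<^bsub>R\<^esub> y"
  "\<zero>\<^bsub>centre_ring R\<^esub> = \<zero>\<^bsub>R\<^esub>"
  "\<one>\<^bsub>centre_ring R\<^esub> = \<one>\<^bsub>R\<^esub>"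
  by (simp_all add: centre_ring_def)

text \<open>Elementwise primality for central factors restricts to the centre, and there it is the
  same as primality on ideals by commutativity.\<close>

lemma (in ring) nc_primeideal_rho_min:
  assumes "nc_primeideal P R"
  shows "nc_primeideal (rho_min R P) (centre_ring R)"
proof -
  interpret P: nc_primeideal P R by fact
  interpret Z: cring "centre_ring R" by (rule centre_ring_is_cring)
  note Z_closed = Z.m_closed [simplified] Z.a_closed [simplified] Z.a_inv_closed [simplified]
    Z.zero_closed [simplified] Z.one_closed [simplified]
  have "ideal (rho_min R P) (centre_ring R)"
  proof (intro idealI Z.ring_axioms Z.add.subgroupI)
    show "rho_min R P \<noteq> {}" using Z_closed(4) P.zero_closed unfolding rho_min_def by blast
    fix a assume a: "a \<in> rho_min R P"
    then have aZ: "a \<in> centre R" and aP: "a \<in> P" by (auto simp: rho_min_def)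
    \<comment> \<open>The negative is the one formed in the centre. It need not be identified with
      that of \<open>R\<close>: its sum with \<open>a\<close> is zero, hence in \<open>P\<close>,
      and \<open>a\<close> can be cancelled.\<close>
    have "a \<oplus> \<ominus>\<^bsub>centre_ring R\<^esub> a = \<zero>" using Z.r_neg [of a] aZ by simp
    then have "\<ominus>\<^bsub>centre_ring R\<^esub> a \<in> P"
      using ideal_add_right_cancel [OF P.is_ideal aP centreD(1) [OF Z_closed(3) [OF aZ]]]
        P.zero_closed by simp
    then show "\<ominus>\<^bsub>centre_ring R\<^esub> a \<in> rho_min R P"
      using Z_closed(3) [OF aZ] by (simp add: rho_min_def)
    fix x assume "x \<in> carrier (centre_ring R)"
    then show "x \<otimes>\<^bsub>centre_ring R\<^esub> a \<in> rho_min R P" "a \<otimes>\<^bsub>centre_ring R\<^esub> x \<in> rho_min R P"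
      using a Z_closed(1) P.I_l_closed P.I_r_closed centreD(1) [of x R] by (simp_all add: rho_min_def)
  next
    fix a b assume "a \<in> rho_min R P" "b \<in> rho_min R P"
    then show "a \<oplus>\<^bsub>centre_ring R\<^esub> b \<in> rho_min R P"
      using Z_closed(2) P.a_closed by (simp add: rho_min_def)
  qed (simp add: rho_min_def)
  moreover have "carrier (centre_ring R) \<noteq> rho_min R P"
    using P.one_imp_carrier P.proper Z_closed(5) unfolding rho_min_def centre_ring_simps by blast
  ultimately have "primeideal (rho_min R P) (centre_ring R)"
  proof (intro primeidealI Z.is_cring)
    fix a b
    assume "a \<in> carrier (centre_ring R)" "b \<in> carrier (centre_ring R)"
      "a \<otimes>\<^bsub>centre_ring R\<^esub> b \<in> rho_min R P"
    then show "a \<in> rho_min R P \<or> b \<in> rho_min R P"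
      using nc_primeideal_centre_mult [OF assms, of a b] centreD(1) [of b R]
      by (simp add: rho_min_def)
  qed
  then show ?thesis by (simp add: Z.nc_primeideal_iff_primeideal)
qed

section \<open>Regular central elements of a semiprime ring\<close>

context semiprime_ring
begin

text \<open>Every prime contains a minimal one, so the minimal primes already cut out the prime
  radical.\<close>

lemma minimal_primes_Inter_zero:
  assumes "x \<in> carrier R" "\<And>P. P \<in> minimal_primes R \<Longrightarrow> x \<in> P"
  shows "x = \<zero>"
proof -
  have "x \<in> {x \<in> carrier R. \<forall>P. nc_primeideal P R \<longrightarrow> x \<in> P}"
    using assms minimal_prime_below by blast
  then show ?thesis by (simp add: prime_radical_zero)
qed

lemma semiprime_centre_ring: "semiprime_ring (centre_ring R)"
proof -
  interpret Z: cring "centre_ring R" by (rule centre_ring_is_cring)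
  have "x = \<zero>" if x: "x \<in> centre R" "\<And>P. nc_primeideal P (centre_ring R) \<Longrightarrow> x \<in> P" for x
  proof (rule minimal_primes_Inter_zero)
    show "x \<in> carrier R" using x(1) by (rule centreD)
    show "x \<in> P" if "P \<in> minimal_primes R" for P
      using x(2) [OF nc_primeideal_rho_min [OF minimal_primesD(1) [OF that]]]
      by (simp add: rho_min_def)
  qed
  moreover have "\<zero> \<in> P" if "nc_primeideal P (centre_ring R)" for P
    using additive_subgroup.zero_closed [OF ideal.axioms(1) [OF nc_primeideal.axioms(1) [OF that]]]
    by simp
  ultimately have
    "{x \<in> carrier (centre_ring R). \<forall>P. nc_primeideal P (centre_ring R) \<longrightarrow> x \<in> P}
      = {\<zero>\<^bsub>centre_ring R\<^esub>}"
    using Z.zero_closed unfolding centre_ring_simps by blast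
  then show ?thesis by unfold_locales
qed

lemma centre_regular_iff:
  assumes fin: "finite (minimal_primes R)" and c: "c \<in> centre R"
  shows "c \<in> regular_elements R \<longleftrightarrow> (\<forall>P\<in>minimal_primes R. c \<notin> P)"
proof
  note cR = centreD [OF c]
  have id: "ideal Q R" if "Q \<in> minimal_primes R" for Q
    using minimal_primesD(1) [OF that] by (rule nc_primeideal.axioms)
  assume reg: "c \<in> regular_elements R"
  show "\<forall>P\<in>minimal_primes R. c \<notin> P"
  proof (intro ballI notI)
    fix P assume P: "P \<in> minimal_primes R" and cP: "c \<in> P"
    note PP = minimal_primesD [OF P]
    interpret P: nc_primeideal P R by (rule PP)
    \<comment> \<open>Otherwise one of the finitely many other minimal primes would lie inside
      \<open>P\<close>, against minimality. The resulting \<open>s\<close> is killed by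
      \<open>c\<close>, since \<open>c \<otimes> s\<close> lies in \<open>P\<close> through
      \<open>c\<close> and in the others through \<open>s\<close>.\<close>
    have "\<not> carrier R \<inter> \<Inter>(minimal_primes R - {P}) \<subseteq> P"
    proof
      assume "carrier R \<inter> \<Inter>(minimal_primes R - {P}) \<subseteq> P"
      then have "\<exists>Q\<in>minimal_primes R - {P}. Q \<subseteq> P"
        by (intro nc_primeideal_Inter [OF PP(1)]) (use fin id in auto)
      then show False using PP(2) minimal_primesD(1) by blast
    qed
    then obtain s where s: "s \<in> carrier R" "s \<notin> P"
        "\<And>Q. Q \<in> minimal_primes R \<Longrightarrow> Q \<noteq> P \<Longrightarrow> s \<in> Q"
      by auto
    have "c \<otimes> s = \<zero>"
    proof (rule minimal_primes_Inter_zero)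
      show "c \<otimes> s \<in> carrier R" using cR(1) s(1) by simp
      show "c \<otimes> s \<in> Q" if "Q \<in> minimal_primes R" for Q
        using that s P.I_r_closed [OF cP s(1)] ideal.I_l_closed [OF id [OF that] s(3) [OF that] cR(1)]
        by (cases "Q = P") auto
    qed
    then have "s = \<zero>" using reg s(1) unfolding regular_elements_def by blast
    then show False using s(2) P.zero_closed by simp
  qed
next
  note cR = centreD [OF c]
  assume avoid: "\<forall>P\<in>minimal_primes R. c \<notin> P"
  \<comment> \<open>One side suffices because \<open>c\<close> is central. Each minimal prime
    contains the product zero but not \<open>c\<close>, hence contains \<open>x\<close>.\<close>
  have "x = \<zero>" if x: "x \<in> carrier R" "c \<otimes> x = \<zero>" for x
  proof (rule minimal_primes_Inter_zero [OF x(1)])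
    fix P assume P: "P \<in> minimal_primes R"
    interpret P: nc_primeideal P R by (rule minimal_primesD [OF P])
    show "x \<in> P"
      using nc_primeideal_centre_mult [OF minimal_primesD(1) [OF P] c x(1)] avoid P x(2)
        P.zero_closed by auto
  qed
  then show "c \<in> regular_elements R"
    using cR unfolding regular_elements_def by simp
qed

end

theorem proposition1p9:
  fixes R :: "('a, 'm) ring_scheme"
  assumes "semiprime_ring R"
    and "finite (minimal_primes R)"
    and "finite (minimal_primes (centre_ring R))"
  shows
    "(regular_elements (centre_ring R) \<subseteq> regular_elements R
        \<longleftrightarrow> (\<forall>P \<in> minimal_primes R. regular_elements (centre_ring R) \<inter> P = {}))
     \<and> ((\<forall>P \<in> minimal_primes R. regular_elements (centre_ring R) \<inter> P = {})
        \<longleftrightarrow> rho_min R \<in> minimal_primes R \<rightarrow> minimal_primes (centre_ring R))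
     \<and> (rho_min R \<in> minimal_primes R \<rightarrow> minimal_primes (centre_ring R)
        \<longleftrightarrow> rho_min R \<in> minimal_primes R \<rightarrow> minimal_primes (centre_ring R)
            \<and> rho_min R ` minimal_primes R = minimal_primes (centre_ring R))"
proof -
  let ?Z = "centre_ring R"
  interpret semiprime_ring R by fact
  interpret Z: cring ?Z by (rule centre_ring_is_cring)
  interpret Z: semiprime_ring ?Z by (rule semiprime_centre_ring)
  \<comment> \<open>The regularity criterion speaks of central elements; this identity makes it
    apply to every element of \<open>?Z\<close>.\<close>
  have centre_Z: "centre ?Z = centre R"
    using Z.m_comm unfolding centre_def [of ?Z] centre_ring_simps by blast
  have regZ: "c \<in> regular_elements ?Z \<longleftrightarrow> c \<in> centre R \<and> (\<forall>q\<in>minimal_primes ?Z. c \<notin> q)" for c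
  proof (cases "c \<in> centre R")
    case True
    then show ?thesis using Z.centre_regular_iff [OF assms(3), unfolded centre_Z] by blast
  qed (simp add: regular_elements_def)
  have rho_prime: "nc_primeideal (rho_min R P) ?Z" if "P \<in> minimal_primes R" for P
    using nc_primeideal_rho_min [OF minimal_primesD(1) [OF that]] .
  have regR: "c \<in> regular_elements R \<longleftrightarrow> (\<forall>P\<in>minimal_primes R. c \<notin> P)"
    if "c \<in> regular_elements ?Z" for c
    using that regZ centre_regular_iff [OF assms(2)] by simp
  then have one_two: "regular_elements ?Z \<subseteq> regular_elements R
      \<longleftrightarrow> (\<forall>P \<in> minimal_primes R. regular_elements ?Z \<inter> P = {})"
    by blast
  have two_three: "(\<forall>P \<in> minimal_primes R. regular_elements ?Z \<inter> P = {})
      \<longleftrightarrow> rho_min R \<in> minimal_primes R \<rightarrow> minimal_primes ?Z"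
  proof
    assume disj: "\<forall>P \<in> minimal_primes R. regular_elements ?Z \<inter> P = {}"
    show "rho_min R \<in> minimal_primes R \<rightarrow> minimal_primes ?Z"
    proof
      fix P assume P: "P \<in> minimal_primes R"
      \<comment> \<open>By \<open>regZ\<close>, an element of the centre that is not regular there
        lies in a minimal prime of the centre, so disjointness places the contraction inside their
        union.\<close>
      have "\<exists>q\<in>minimal_primes ?Z. rho_min R P \<subseteq> q"
      proof (rule Z.nc_prime_avoidance [OF assms(3)])
        show "rho_min R P \<subseteq> \<Union>(minimal_primes ?Z)"
          using disj P regZ unfolding rho_min_def by blast
      qed (use minimal_primesD(1) nc_primeideal.axioms(1) [OF rho_prime [OF P]] in auto)
      then show "rho_min R P \<in> minimal_primes ?Z"
        using minimal_primesD(2) rho_prime [OF P] by metis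
    qed
  next
    assume "rho_min R \<in> minimal_primes R \<rightarrow> minimal_primes ?Z"
    then show "\<forall>P \<in> minimal_primes R. regular_elements ?Z \<inter> P = {}"
      using regZ unfolding rho_min_def by blast
  qed
  \<comment> \<open>Each \<open>q\<close> contains the zero intersection of the finitely many
    contractions, hence one of them, and minimality of \<open>q\<close> turns this inclusion into
    equality. So well-definedness already yields surjectivity.\<close>
  have "minimal_primes ?Z \<subseteq> rho_min R ` minimal_primes R"
  proof
    fix q assume q: "q \<in> minimal_primes ?Z"
    interpret q: nc_primeideal q ?Z by (rule minimal_primesD [OF q])
    have "carrier ?Z \<inter> \<Inter>(rho_min R ` minimal_primes R) \<subseteq> {\<zero>\<^bsub>R\<^esub>}"
    proof
      fix x assume x: "x \<in> carrier ?Z \<inter> \<Inter>(rho_min R ` minimal_primes R)"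
      then have "x = \<zero>\<^bsub>R\<^esub>"
        using centreD(1) [of x R] unfolding rho_min_def centre_ring_simps
        by (intro minimal_primes_Inter_zero) blast+
      then show "x \<in> {\<zero>\<^bsub>R\<^esub>}" by simp
    qed
    then have "carrier ?Z \<inter> \<Inter>(rho_min R ` minimal_primes R) \<subseteq> q"
      using q.zero_closed by auto
    then have "\<exists>p\<in>rho_min R ` minimal_primes R. p \<subseteq> q"
      by (intro Z.nc_primeideal_Inter [OF minimal_primesD(1) [OF q]])
        (use assms(2) nc_primeideal.axioms(1) [OF rho_prime] in auto)
    then show "q \<in> rho_min R ` minimal_primes R"
      using minimal_primesD(2) [OF q] rho_prime by fast
  qed
  then show ?thesis using one_two two_three by auto
qed

end
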